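(* Let $\mathbb{K}$ be a field of characteristic not $2$, let $\mathfrak{a}$ be a Lie affgebra over $\mathbb{K}$, and let $o\in\mathfrak{a}$ be such that $\mathfrak{a}=\mathfrak{a}(T_o\mathfrak{a};0,0,s)$ for some $s\in T_o\mathfrak{a}$; that is, the affine Lie bracket is $\{a,b\}=[a,b]+s$, where $[-,-]$ is the Lie bracket of the tangent Lie algebra $T_o\mathfrak{a}$. Assume $\mathrm{ad}_s=0$, i.e. $[s,x]=0$ for all $x\in T_o\mathfrak{a}$. Then $\mathfrak{a}$ is an affinely nilpotent Lie affgebra if and only if $T_o\mathfrak{a}$ is a nilpotent Lie algebra.
   Context: For a Lie algebra $(\mathfrak{g},[-,-])$ over $\mathbb{K}$, linear maps $\kappa,\lambda:\mathfrak{g}\to\mathfrak{g}$ with $\lambda([a,b])=[\lambda(a),b]+[a,\lambda(b)]-[a,\kappa(b)]$ for all $a,b\in\mathfrak{g}$, and $s\in\mathfrak{g}$, the Lie affgebra $\mathfrak{a}(\mathfrak{g};\kappa,\lambda,s)$ is the set $\mathfrak{g}$ with its affine space structure $\langle a,b,c\rangle=a-b+c$, $\alpha\triangleright_a b=(1-\alpha)a+\alpha b$, and the affine Lie bracket $\{a,b\}=[a,b]+\kappa(a)+\lambda(b-a)+s$. For a Lie affgebra $\mathfrak{a}$ and $o\in\mathfrak{a}$, $T_o\mathfrak{a}$ is the vector space obtained from the affine space $\mathfrak{a}$ by choosing $o$ as origin ($a+b=\langle a,o,b\rangle$, $\alpha\cdot a=\alpha\triangleright_o a$), with Lie bracket $[a,b]=\{a,b\}-\{a,o\}+\{o,o\}-\{o,b\}$.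 (So in the present case $\mathfrak{a}$ is $\mathfrak{a}(\mathfrak{g};0,0,s)$ with $\mathfrak{g}=T_o\mathfrak{a}$ and $o$ the zero of $\mathfrak{g}$.) Set $E:=\{x\in\mathfrak{a}\mid\{x,a\}=\{a,x\}=x\ \text{for all } a\in\mathfrak{a}\}$ (either empty or a singleton). For affine subspaces $\mathfrak{b},\mathfrak{c}$ of $\mathfrak{a}$, $\{\mathfrak{b},\mathfrak{c}\}$ is the smallest affine subspace containing all $\{x,y\}$ with $x\in\mathfrak{b}$, $y\in\mathfrak{c}$. Put $\mathfrak{a}^{(0)}=\mathfrak{a}$, $\mathfrak{a}^{(m)}=\{\mathfrak{a},\mathfrak{a}^{(m-1)}\}$ for $m\ge1$. Then $\mathfrak{a}$ is affinely nilpotent if there is a positive integer $n$ with $\mathfrak{a}^{(n+k)}=\mathfrak{a}^{(n)}=E$ for all $k\in\mathbb{N}$. *)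

theory Defs
  imports "HOL-Algebra.Algebra" "HOL.Hull"
begin

text \<open>Zero if no positive multiple of the unit vanishes.\<close>

definition ring_char :: "('k, 'm) ring_scheme \<Rightarrow> nat" where
  "ring_char K = group.ord (add_monoid K) \<one>\<^bsub>K\<^esub>"


section \<open>Affine spaces and Lie affgebras\<close>

record ('k, 'a) affgebra = "'a partial_object" +
  tern :: "'a \<Rightarrow> 'a \<Rightarrow> 'a \<Rightarrow> 'a"  (\<open>\<langle>_, _, _\<rangle>\<index>\<close>)
  act :: "'k \<Rightarrow> 'a \<Rightarrow> 'a \<Rightarrow> 'a"
  abr :: "'a \<Rightarrow> 'a \<Rightarrow> 'a"  (\<open>\<lbrace>_, _\<rbrace>\<index>\<close>)

text \<open>
  Affine spaces are given without a chosen origin, as an abelian heap \<open>\<langle>a, b, c\<rangle>\<close> together with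
  an action; \<open>act A \<alpha> a b\<close> is the point \<open>\<alpha> \<triangleright>\<^sub>a b\<close> that divides the pair \<open>(a, b)\<close> in the
  ratio \<open>\<alpha>\<close>. The empty affine space is allowed.
\<close>

locale affine_space = K?: field K for K (structure) and A (structure) +
  assumes tern_closed:
      "\<lbrakk>a \<in> carrier A; b \<in> carrier A; c \<in> carrier A\<rbrakk> \<Longrightarrow> \<langle>a, b, c\<rangle>\<^bsub>A\<^esub> \<in> carrier A"
    and tern_assoc:
      "\<lbrakk>a \<in> carrier A; b \<in> carrier A; c \<in> carrier A; d \<in> carrier A; e \<in> carrier A\<rbrakk> \<Longrightarrow>
       \<langle>\<langle>a, b, c\<rangle>\<^bsub>A\<^esub>, d, e\<rangle>\<^bsub>A\<^esub> = \<langle>a, b, \<langle>c, d, e\<rangle>\<^bsub>A\<^esub>\<rangle>\<^bsub>A\<^esub>"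
    and tern_left: "\<lbrakk>a \<in> carrier A; b \<in> carrier A\<rbrakk> \<Longrightarrow> \<langle>a, a, b\<rangle>\<^bsub>A\<^esub> = b"
    and tern_right: "\<lbrakk>a \<in> carrier A; b \<in> carrier A\<rbrakk> \<Longrightarrow> \<langle>b, a, a\<rangle>\<^bsub>A\<^esub> = b"
    and tern_comm:
      "\<lbrakk>a \<in> carrier A; b \<in> carrier A; c \<in> carrier A\<rbrakk> \<Longrightarrow> \<langle>a, b, c\<rangle>\<^bsub>A\<^esub> = \<langle>c, b, a\<rangle>\<^bsub>A\<^esub>"
    and act_closed:
      "\<lbrakk>\<alpha> \<in> carrier K; a \<in> carrier A; b \<in> carrier A\<rbrakk> \<Longrightarrow> act A \<alpha> a b \<in> carrier A"
    and act_scalar_tern: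
      "\<lbrakk>\<alpha> \<in> carrier K; \<beta> \<in> carrier K; \<gamma> \<in> carrier K; a \<in> carrier A; b \<in> carrier A\<rbrakk> \<Longrightarrow>
       act A (\<alpha> \<ominus>\<^bsub>K\<^esub> \<beta> \<oplus>\<^bsub>K\<^esub> \<gamma>) a b = \<langle>act A \<alpha> a b, act A \<beta> a b, act A \<gamma> a b\<rangle>\<^bsub>A\<^esub>"
    and act_tern:
      "\<lbrakk>\<alpha> \<in> carrier K; a \<in> carrier A; b \<in> carrier A; c \<in> carrier A; d \<in> carrier A\<rbrakk> \<Longrightarrow>
       act A \<alpha> a \<langle>b, c, d\<rangle>\<^bsub>A\<^esub> = \<langle>act A \<alpha> a b, act A \<alpha> a c, act A \<alpha> a d\<rangle>\<^bsub>A\<^esub>"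
    and act_mult:
      "\<lbrakk>\<alpha> \<in> carrier K; \<beta> \<in> carrier K; a \<in> carrier A; b \<in> carrier A\<rbrakk> \<Longrightarrow>
       act A (\<alpha> \<otimes>\<^bsub>K\<^esub> \<beta>) a b = act A \<alpha> a (act A \<beta> a b)"
    and act_zero: "\<lbrakk>a \<in> carrier A; b \<in> carrier A\<rbrakk> \<Longrightarrow> act A \<zero>\<^bsub>K\<^esub> a b = a"
    and act_one: "\<lbrakk>a \<in> carrier A; b \<in> carrier A\<rbrakk> \<Longrightarrow> act A \<one>\<^bsub>K\<^esub> a b = b"
    and act_base_change:
      "\<lbrakk>\<alpha> \<in> carrier K; a \<in> carrier A; b \<in> carrier A; c \<in> carrier A\<rbrakk> \<Longrightarrow>
       act A \<alpha> a b = \<langle>act A \<alpha> c b, act A \<alpha> c a, a\<rangle>\<^bsub>A\<^esub>"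

definition affine_map_on ::
    "('k, 'm) ring_scheme \<Rightarrow> ('k, 'a, 'n) affgebra_scheme \<Rightarrow> ('a \<Rightarrow> 'a) \<Rightarrow> bool" where
  "affine_map_on K A f \<longleftrightarrow>
     f \<in> carrier A \<rightarrow> carrier A \<and>
     (\<forall>a\<in>carrier A. \<forall>b\<in>carrier A. \<forall>c\<in>carrier A.
        f \<langle>a, b, c\<rangle>\<^bsub>A\<^esub> = \<langle>f a, f b, f c\<rangle>\<^bsub>A\<^esub>) \<and>
     (\<forall>\<alpha>\<in>carrier K. \<forall>a\<in>carrier A. \<forall>b\<in>carrier A.
        f (act A \<alpha> a b) = act A \<alpha> (f a) (f b))"

locale lie_affgebra = affine_space K A for K (structure) and A (structure) +
  assumes abr_affine_left: "b \<in> carrier A \<Longrightarrow> affine_map_on K A (\<lambda>a. \<lbrace>a, b\<rbrace>\<^bsub>A\<^esub>)"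
    and abr_affine_right: "a \<in> carrier A \<Longrightarrow> affine_map_on K A (\<lambda>b. \<lbrace>a, b\<rbrace>\<^bsub>A\<^esub>)"
    and abr_antisym:
      "\<lbrakk>a \<in> carrier A; b \<in> carrier A\<rbrakk> \<Longrightarrow>
       \<langle>\<lbrace>a, b\<rbrace>\<^bsub>A\<^esub>, \<lbrace>a, a\<rbrace>\<^bsub>A\<^esub>, \<lbrace>b, a\<rbrace>\<^bsub>A\<^esub>\<rangle>\<^bsub>A\<^esub> = \<lbrace>b, b\<rbrace>\<^bsub>A\<^esub>"
    and abr_jacobi:
      "\<lbrakk>a \<in> carrier A; b \<in> carrier A; c \<in> carrier A\<rbrakk> \<Longrightarrow>
       \<langle>\<langle>\<lbrace>a, \<lbrace>b, c\<rbrace>\<^bsub>A\<^esub>\<rbrace>\<^bsub>A\<^esub>, \<lbrace>a, \<lbrace>a, a\<rbrace>\<^bsub>A\<^esub>\<rbrace>\<^bsub>A\<^esub>, \<lbrace>b, \<lbrace>c, a\<rbrace>\<^bsub>A\<^esub>\<rbrace>\<^bsub>A\<^esub>\<rangle>\<^bsub>A\<^esub>,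
          \<lbrace>b, \<lbrace>b, b\<rbrace>\<^bsub>A\<^esub>\<rbrace>\<^bsub>A\<^esub>, \<lbrace>c, \<lbrace>a, b\<rbrace>\<^bsub>A\<^esub>\<rbrace>\<^bsub>A\<^esub>\<rangle>\<^bsub>A\<^esub> = \<lbrace>c, \<lbrace>c, c\<rbrace>\<^bsub>A\<^esub>\<rbrace>\<^bsub>A\<^esub>"

text \<open>Equality of affgebras, ignoring the values of the operations outside the carriers.\<close>

definition affgebra_eq ::
    "('k, 'm) ring_scheme \<Rightarrow> ('k, 'a) affgebra \<Rightarrow> ('k, 'a) affgebra \<Rightarrow> bool" where
  "affgebra_eq K A B \<longleftrightarrow>
     carrier A = carrier B \<and>
     (\<forall>a\<in>carrier A. \<forall>b\<in>carrier A. \<forall>c\<in>carrier A. \<langle>a, b, c\<rangle>\<^bsub>A\<^esub> = \<langle>a, b, c\<rangle>\<^bsub>B\<^esub>) \<and>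
     (\<forall>\<alpha>\<in>carrier K. \<forall>a\<in>carrier A. \<forall>b\<in>carrier A. act A \<alpha> a b = act B \<alpha> a b) \<and>
     (\<forall>a\<in>carrier A. \<forall>b\<in>carrier A. \<lbrace>a, b\<rbrace>\<^bsub>A\<^esub> = \<lbrace>a, b\<rbrace>\<^bsub>B\<^esub>)"


section \<open>Lie algebras\<close>

text \<open>
  The multiplication \<open>\<otimes>\<^bsub>L\<^esub>\<close> of the module record serves as the Lie bracket; the field
  \<open>\<one>\<^bsub>L\<^esub>\<close> is not used.
\<close>

locale lie_algebra = K?: field K + module K L for K (structure) and L (structure) +
  assumes lie_closed:
      "\<lbrakk>x \<in> carrier L; y \<in> carrier L\<rbrakk> \<Longrightarrow> x \<otimes>\<^bsub>L\<^esub> y \<in> carrier L"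
    and lie_add_left:
      "\<lbrakk>x \<in> carrier L; y \<in> carrier L; z \<in> carrier L\<rbrakk> \<Longrightarrow>
       (x \<oplus>\<^bsub>L\<^esub> y) \<otimes>\<^bsub>L\<^esub> z = (x \<otimes>\<^bsub>L\<^esub> z) \<oplus>\<^bsub>L\<^esub> (y \<otimes>\<^bsub>L\<^esub> z)"
    and lie_add_right:
      "\<lbrakk>x \<in> carrier L; y \<in> carrier L; z \<in> carrier L\<rbrakk> \<Longrightarrow>
       x \<otimes>\<^bsub>L\<^esub> (y \<oplus>\<^bsub>L\<^esub> z) = (x \<otimes>\<^bsub>L\<^esub> y) \<oplus>\<^bsub>L\<^esub> (x \<otimes>\<^bsub>L\<^esub> z)"
    and lie_smult_left:
      "\<lbrakk>\<alpha> \<in> carrier K; x \<in> carrier L; y \<in> carrier L\<rbrakk> \<Longrightarrow>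
       (\<alpha> \<odot>\<^bsub>L\<^esub> x) \<otimes>\<^bsub>L\<^esub> y = \<alpha> \<odot>\<^bsub>L\<^esub> (x \<otimes>\<^bsub>L\<^esub> y)"
    and lie_smult_right:
      "\<lbrakk>\<alpha> \<in> carrier K; x \<in> carrier L; y \<in> carrier L\<rbrakk> \<Longrightarrow>
       x \<otimes>\<^bsub>L\<^esub> (\<alpha> \<odot>\<^bsub>L\<^esub> y) = \<alpha> \<odot>\<^bsub>L\<^esub> (x \<otimes>\<^bsub>L\<^esub> y)"
    and lie_alternating: "x \<in> carrier L \<Longrightarrow> x \<otimes>\<^bsub>L\<^esub> x = \<zero>\<^bsub>L\<^esub>"
    and lie_jacobi:
      "\<lbrakk>x \<in> carrier L; y \<in> carrier L; z \<in> carrier L\<rbrakk> \<Longrightarrow>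
       (x \<otimes>\<^bsub>L\<^esub> (y \<otimes>\<^bsub>L\<^esub> z)) \<oplus>\<^bsub>L\<^esub> (y \<otimes>\<^bsub>L\<^esub> (z \<otimes>\<^bsub>L\<^esub> x)) \<oplus>\<^bsub>L\<^esub> (z \<otimes>\<^bsub>L\<^esub> (x \<otimes>\<^bsub>L\<^esub> y)) = \<zero>\<^bsub>L\<^esub>"

definition lie_bracket_sets ::
    "('k, 'm) ring_scheme \<Rightarrow> ('k, 'a, 'n) module_scheme \<Rightarrow> 'a set \<Rightarrow> 'a set \<Rightarrow> 'a set" where
  "lie_bracket_sets K L B C =
     (\<lambda>H. submodule H K L) hull {x \<otimes>\<^bsub>L\<^esub> y | x y. x \<in> B \<and> y \<in> C}"

primrec lower_central_series ::
    "('k, 'm) ring_scheme \<Rightarrow> ('k, 'a, 'n) module_scheme \<Rightarrow> nat \<Rightarrow> 'a set" where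
  "lower_central_series K L 0 = carrier L"
| "lower_central_series K L (Suc m) =
     lie_bracket_sets K L (carrier L) (lower_central_series K L m)"

definition nilpotent_lie_algebra ::
    "('k, 'm) ring_scheme \<Rightarrow> ('k, 'a, 'n) module_scheme \<Rightarrow> bool" where
  "nilpotent_lie_algebra K L \<longleftrightarrow>
     lie_algebra K L \<and> (\<exists>n. lower_central_series K L n = {\<zero>\<^bsub>L\<^esub>})"


section \<open>Passing between Lie affgebras and Lie algebras\<close>

definition tangent_space :: "('k, 'a) affgebra \<Rightarrow> 'a \<Rightarrow> ('k, 'a) module" where
  "tangent_space A p =
     \<lparr>carrier = carrier A, monoid.mult = (\<lambda>a b. undefined), one = undefined,
      ring.zero = p, ring.add = (\<lambda>a b. \<langle>a, p, b\<rangle>\<^bsub>A\<^esub>), smult = (\<lambda>\<alpha> a. act A \<alpha> p a)\<rparr>"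

definition tangent_lie_algebra :: "('k, 'a) affgebra \<Rightarrow> 'a \<Rightarrow> ('k, 'a) module" where
  "tangent_lie_algebra A p =
     (let T = tangent_space A p in
      T\<lparr>monoid.mult := (\<lambda>a b. \<lbrace>a, b\<rbrace>\<^bsub>A\<^esub> \<ominus>\<^bsub>T\<^esub> \<lbrace>a, p\<rbrace>\<^bsub>A\<^esub> \<oplus>\<^bsub>T\<^esub> \<lbrace>p, p\<rbrace>\<^bsub>A\<^esub> \<ominus>\<^bsub>T\<^esub> \<lbrace>p, b\<rbrace>\<^bsub>A\<^esub>)\<rparr>)"

text \<open>
  This is a Lie affgebra when \<open>L\<close> is a Lie algebra, \<open>s\<close> is an element of \<open>L\<close>, and \<open>\<kappa>\<close>, \<open>\<Lambda>\<close> are linear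
  with \<open>\<Lambda> [a, b] = [\<Lambda> a, b] + [a, \<Lambda> b] - [a, \<kappa> b]\<close>; this is not part of the definition.
\<close>

definition affgebra_of ::
    "('k, 'm) ring_scheme \<Rightarrow> ('k, 'a) module \<Rightarrow> ('a \<Rightarrow> 'a) \<Rightarrow> ('a \<Rightarrow> 'a) \<Rightarrow> 'a \<Rightarrow> ('k, 'a) affgebra"
  where
  "affgebra_of K L \<kappa> \<Lambda> s =
     \<lparr>carrier = carrier L,
      tern = (\<lambda>a b c. a \<ominus>\<^bsub>L\<^esub> b \<oplus>\<^bsub>L\<^esub> c),
      act = (\<lambda>\<alpha> a b. (\<one>\<^bsub>K\<^esub> \<ominus>\<^bsub>K\<^esub> \<alpha>) \<odot>\<^bsub>L\<^esub> a \<oplus>\<^bsub>L\<^esub> \<alpha> \<odot>\<^bsub>L\<^esub> b),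
      abr = (\<lambda>a b. (a \<otimes>\<^bsub>L\<^esub> b) \<oplus>\<^bsub>L\<^esub> \<kappa> a \<oplus>\<^bsub>L\<^esub> \<Lambda> (b \<ominus>\<^bsub>L\<^esub> a) \<oplus>\<^bsub>L\<^esub> s)\<rparr>"


section \<open>Affine nilpotency\<close>

text \<open>
  The empty set counts as an affine subspace, so that smallest affine subspaces always exist.
\<close>

definition affine_subspace ::
    "('k, 'm) ring_scheme \<Rightarrow> ('k, 'a, 'n) affgebra_scheme \<Rightarrow> 'a set \<Rightarrow> bool" where
  "affine_subspace K A B \<longleftrightarrow>
     B \<subseteq> carrier A \<and>
     (\<forall>a\<in>B. \<forall>b\<in>B. \<forall>c\<in>B. \<langle>a, b, c\<rangle>\<^bsub>A\<^esub> \<in> B) \<and>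
     (\<forall>\<alpha>\<in>carrier K. \<forall>a\<in>B. \<forall>b\<in>B. act A \<alpha> a b \<in> B)"

definition affine_bracket_sets ::
    "('k, 'm) ring_scheme \<Rightarrow> ('k, 'a, 'n) affgebra_scheme \<Rightarrow> 'a set \<Rightarrow> 'a set \<Rightarrow> 'a set" where
  "affine_bracket_sets K A B C = affine_subspace K A hull {\<lbrace>x, y\<rbrace>\<^bsub>A\<^esub> | x y. x \<in> B \<and> y \<in> C}"

primrec affine_lower_central_series ::
    "('k, 'm) ring_scheme \<Rightarrow> ('k, 'a, 'n) affgebra_scheme \<Rightarrow> nat \<Rightarrow> 'a set" where
  "affine_lower_central_series K A 0 = carrier A"
| "affine_lower_central_series K A (Suc m) =
     affine_bracket_sets K A (carrier A) (affine_lower_central_series K A m)"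

definition absorbing_set :: "('k, 'a, 'n) affgebra_scheme \<Rightarrow> 'a set" where
  "absorbing_set A =
     {x \<in> carrier A. \<forall>a\<in>carrier A. \<lbrace>x, a\<rbrace>\<^bsub>A\<^esub> = x \<and> \<lbrace>a, x\<rbrace>\<^bsub>A\<^esub> = x}"

definition affinely_nilpotent ::
    "('k, 'm) ring_scheme \<Rightarrow> ('k, 'a, 'n) affgebra_scheme \<Rightarrow> bool" where
  "affinely_nilpotent K A \<longleftrightarrow>
     lie_affgebra K A \<and>
     (\<exists>n>0. \<forall>k. affine_lower_central_series K A (n + k) = affine_lower_central_series K A n \<and>
                affine_lower_central_series K A n = absorbing_set A)"

end

theory Submission
  imports Defs
begin

text \<open>
  As \<open>s\<close> is central, translation by \<open>s\<close> carries the lower central series of the tangent Lie algebra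
  onto the affine lower central series: each affine span of brackets contains \<open>{0, y} = s\<close>, and an
  affine subspace through \<open>s\<close> is the translate by \<open>s\<close> of a linear subspace. The only absorbing element
  is \<open>s\<close>, so the affine series stabilises at it exactly when the linear series reaches zero.
\<close>

section \<open>The tangent space at a point as a vector space\<close>

lemma tangent_lie_algebra_simps:
  "carrier (tangent_lie_algebra A p) = carrier A"
  "\<zero>\<^bsub>tangent_lie_algebra A p\<^esub> = p"
  "x \<oplus>\<^bsub>tangent_lie_algebra A p\<^esub> y = \<langle>x, p, y\<rangle>\<^bsub>A\<^esub>"
  "\<alpha> \<odot>\<^bsub>tangent_lie_algebra A p\<^esub> x = act A \<alpha> p x"
  by (simp_all add: tangent_lie_algebra_def tangent_space_def Let_def)

lemma tangent_lie_algebra_mult: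
  "x \<otimes>\<^bsub>tangent_lie_algebra A p\<^esub> y =
     \<lbrace>x, y\<rbrace>\<^bsub>A\<^esub> \<ominus>\<^bsub>tangent_lie_algebra A p\<^esub> \<lbrace>x, p\<rbrace>\<^bsub>A\<^esub> \<oplus>\<^bsub>tangent_lie_algebra A p\<^esub> \<lbrace>p, p\<rbrace>\<^bsub>A\<^esub>
       \<ominus>\<^bsub>tangent_lie_algebra A p\<^esub> \<lbrace>p, y\<rbrace>\<^bsub>A\<^esub>"
  by (simp add: tangent_lie_algebra_def tangent_space_def Let_def a_minus_def a_inv_def)

text \<open>Base change with all three points equal to \<open>a\<close> writes the point as itself,
  minus itself, plus \<open>a\<close>.\<close>

lemma (in affine_space) act_same:
  assumes "\<alpha> \<in> carrier K" "a \<in> carrier A"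
  shows "act A \<alpha> a a = a"
  using act_base_change[of \<alpha> a a a] tern_left[of "act A \<alpha> a a" a] act_closed assms by simp

lemma module_tangent_lie_algebra:
  assumes "affine_space K A" and p: "p \<in> carrier A"
  shows "module K (tangent_lie_algebra A p)"
proof (rule module.intro)
  interpret affine_space K A by fact
  show "cring K" by (rule K.is_cring)
  show "abelian_group (tangent_lie_algebra A p)"
  proof (rule abelian_groupI, simp_all only: tangent_lie_algebra_simps)
    fix x assume x: "x \<in> carrier A"
    \<comment> \<open>With \<open>p\<close> as origin, p - x + p is the additive inverse of
      \<open>x\<close>.\<close>
    have "\<langle>\<langle>p, x, p\<rangle>\<^bsub>A\<^esub>, p, x\<rangle>\<^bsub>A\<^esub> = p"
      using x p by (simp add: tern_assoc tern_left tern_right)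
    then show "\<exists>y\<in>carrier A. \<langle>y, p, x\<rangle>\<^bsub>A\<^esub> = p"
      using tern_closed x p by blast
  next
    fix x y assume "x \<in> carrier A" "y \<in> carrier A"
    then show "\<langle>x, p, y\<rangle>\<^bsub>A\<^esub> = \<langle>y, p, x\<rangle>\<^bsub>A\<^esub>"
      using p by (intro tern_comm)
  qed (use p in \<open>auto simp: tern_closed tern_assoc tern_left\<close>)
  show "module_axioms K (tangent_lie_algebra A p)"
  proof (unfold_locales, simp_all only: tangent_lie_algebra_simps)
    fix a b x assume "a \<in> carrier K" "b \<in> carrier K" "x \<in> carrier A"
    \<comment> \<open>Distributivity over scalars is \<open>act_scalar_tern\<close> with middle
      scalar 0, whose action returns the base point \<open>p\<close>.\<close>
    then show "act A (a \<oplus>\<^bsub>K\<^esub> b) p x = \<langle>act A a p x, p, act A b p x\<rangle>\<^bsub>A\<^esub>"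
      using act_scalar_tern[of a "\<zero>\<^bsub>K\<^esub>" b p x] p by (simp add: act_zero K.minus_eq)
  next
    fix a x y assume "a \<in> carrier K" "x \<in> carrier A" "y \<in> carrier A"
    then show "act A a p \<langle>x, p, y\<rangle>\<^bsub>A\<^esub> = \<langle>act A a p x, p, act A a p y\<rangle>\<^bsub>A\<^esub>"
      using p by (simp add: act_tern act_same)
  qed (use p in \<open>auto simp: act_closed act_mult act_one\<close>)
qed

section \<open>Translations and hulls in modules\<close>

lemma (in abelian_group) a_inv_zero: "\<ominus> \<zero> = \<zero>"
  using r_neg[of \<zero>] by simp

lemma (in abelian_group) translate_minus:
  assumes "s \<in> carrier G" "a \<in> carrier G" "b \<in> carrier G" "c \<in> carrier G"
  shows "(s \<oplus> a) \<ominus> (s \<oplus> b) \<oplus> (s \<oplus> c) = s \<oplus> (a \<ominus> b \<oplus> c)"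
proof -
  have "s \<oplus> (\<ominus> b \<oplus> \<ominus> s) = \<ominus> b"
    using assms by (simp add: a_comm[of "\<ominus> b"] r_neg2)
  then show ?thesis
    using assms by (simp add: minus_eq minus_add a_ac)
qed

text \<open>The coefficients 1 - \<alpha> and \<alpha> sum to 1, so the two multiples of
  \<open>s\<close> add up to \<open>s\<close>.\<close>

lemma (in module) translate_smult:
  assumes "\<alpha> \<in> carrier R" "s \<in> carrier M" "a \<in> carrier M" "b \<in> carrier M"
  shows "(\<one> \<ominus> \<alpha>) \<odot>\<^bsub>M\<^esub> (s \<oplus>\<^bsub>M\<^esub> a) \<oplus>\<^bsub>M\<^esub> \<alpha> \<odot>\<^bsub>M\<^esub> (s \<oplus>\<^bsub>M\<^esub> b) =
         s \<oplus>\<^bsub>M\<^esub> ((\<one> \<ominus> \<alpha>) \<odot>\<^bsub>M\<^esub> a \<oplus>\<^bsub>M\<^esub> \<alpha> \<odot>\<^bsub>M\<^esub> b)"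
proof -
  have "(\<one> \<ominus> \<alpha>) \<odot>\<^bsub>M\<^esub> s \<oplus>\<^bsub>M\<^esub> \<alpha> \<odot>\<^bsub>M\<^esub> s = ((\<one> \<ominus> \<alpha>) \<oplus> \<alpha>) \<odot>\<^bsub>M\<^esub> s"
    using assms by (simp add: smult_l_distr)
  also have "(\<one> \<ominus> \<alpha>) \<oplus> \<alpha> = \<one>"
    using assms by (simp add: R.minus_eq R.a_assoc R.l_neg)
  finally have s: "(\<one> \<ominus> \<alpha>) \<odot>\<^bsub>M\<^esub> s \<oplus>\<^bsub>M\<^esub> \<alpha> \<odot>\<^bsub>M\<^esub> s = s"
    using assms by simp
  have "(\<one> \<ominus> \<alpha>) \<odot>\<^bsub>M\<^esub> (s \<oplus>\<^bsub>M\<^esub> a) \<oplus>\<^bsub>M\<^esub> \<alpha> \<odot>\<^bsub>M\<^esub> (s \<oplus>\<^bsub>M\<^esub> b) =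
        ((\<one> \<ominus> \<alpha>) \<odot>\<^bsub>M\<^esub> s \<oplus>\<^bsub>M\<^esub> \<alpha> \<odot>\<^bsub>M\<^esub> s) \<oplus>\<^bsub>M\<^esub> ((\<one> \<ominus> \<alpha>) \<odot>\<^bsub>M\<^esub> a \<oplus>\<^bsub>M\<^esub> \<alpha> \<odot>\<^bsub>M\<^esub> b)"
    using assms by (simp add: smult_r_distr M.a_ac)
  then show ?thesis
    by (simp only: s)
qed

lemma (in module) zero_in_submodule: "submodule H R M \<Longrightarrow> \<zero>\<^bsub>M\<^esub> \<in> H"
  using subgroup.one_closed[of H "add_monoid M"] by (simp add: submodule_def)

text \<open>The hull is a plain intersection. Since \<open>S\<close> lies in the carrier, the
  carrier is one of the submodules intersected; otherwise the family would be empty and its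
  intersection the whole type.\<close>

lemma (in module) submodule_hull:
  assumes "S \<subseteq> carrier M"
  shows "submodule ((\<lambda>H. submodule H R M) hull S) R M"
proof (rule submoduleI)
  show "(\<lambda>H. submodule H R M) hull S \<subseteq> carrier M"
    using assms carrier_is_submodule by (rule hull_minimal)
qed (auto simp: hull_def zero_in_submodule submoduleE)

section \<open>The affine bracket as a translated tangent bracket\<close>

locale central_lie_affgebra = lie_affgebra K A
  for K :: "('k, 'm) ring_scheme" (structure) and A :: "('k, 'a) affgebra" (structure) +
  fixes p s :: 'a
  assumes p_closed: "p \<in> carrier A"
    and s_closed_tangent: "s \<in> carrier (tangent_lie_algebra A p)"
    and eq_affgebra_of: "affgebra_eq K A
           (affgebra_of K (tangent_lie_algebra A p)
              (\<lambda>x. \<zero>\<^bsub>tangent_lie_algebra A p\<^esub>) (\<lambda>x. \<zero>\<^bsub>tangent_lie_algebra A p\<^esub>) s)"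
    and s_central: "\<forall>x \<in> carrier (tangent_lie_algebra A p).
           s \<otimes>\<^bsub>tangent_lie_algebra A p\<^esub> x = \<zero>\<^bsub>tangent_lie_algebra A p\<^esub>"
begin

abbreviation (input) L where "L \<equiv> tangent_lie_algebra A p"

sublocale L: module K L
  using module_tangent_lie_algebra[OF affine_space_axioms p_closed] .

text \<open>Oriented towards \<open>L\<close>, so that membership facts reach the form expected by
  the module lemmas.\<close>

lemma carrier_eq: "carrier A = carrier L"
  by (simp add: tangent_lie_algebra_simps)

lemma s_closed: "s \<in> carrier L"
  by (rule s_closed_tangent)

lemma abr_closed: "\<lbrakk>x \<in> carrier L; y \<in> carrier L\<rbrakk> \<Longrightarrow> \<lbrace>x, y\<rbrace>\<^bsub>A\<^esub> \<in> carrier L"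
  using abr_affine_left[of y] by (auto simp: affine_map_on_def carrier_eq)

lemma bracket_closed: "\<lbrakk>x \<in> carrier L; y \<in> carrier L\<rbrakk> \<Longrightarrow> x \<otimes>\<^bsub>L\<^esub> y \<in> carrier L"
  using p_closed by (simp add: tangent_lie_algebra_mult abr_closed carrier_eq)

lemma tern_eq:
  "\<lbrakk>a \<in> carrier L; b \<in> carrier L; c \<in> carrier L\<rbrakk> \<Longrightarrow> \<langle>a, b, c\<rangle>\<^bsub>A\<^esub> = a \<ominus>\<^bsub>L\<^esub> b \<oplus>\<^bsub>L\<^esub> c"
  using eq_affgebra_of by (simp add: affgebra_eq_def affgebra_of_def carrier_eq)

lemma act_eq:
  "\<lbrakk>\<alpha> \<in> carrier K; a \<in> carrier L; b \<in> carrier L\<rbrakk> \<Longrightarrow>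
     act A \<alpha> a b = (\<one>\<^bsub>K\<^esub> \<ominus>\<^bsub>K\<^esub> \<alpha>) \<odot>\<^bsub>L\<^esub> a \<oplus>\<^bsub>L\<^esub> \<alpha> \<odot>\<^bsub>L\<^esub> b"
  using eq_affgebra_of by (simp add: affgebra_eq_def affgebra_of_def carrier_eq)

text \<open>Writing \<open>s\<close> first gives affine brackets the shape that
  \<open>tern_translate\<close> and \<open>act_translate\<close> match; the common \<open>s\<close>
  then cancels from affine identities.\<close>

lemma abr_eq: "\<lbrakk>x \<in> carrier L; y \<in> carrier L\<rbrakk> \<Longrightarrow> \<lbrace>x, y\<rbrace>\<^bsub>A\<^esub> = s \<oplus>\<^bsub>L\<^esub> x \<otimes>\<^bsub>L\<^esub> y"
  using eq_affgebra_of bracket_closed s_closed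
  by (simp add: affgebra_eq_def affgebra_of_def carrier_eq L.a_comm)

lemma tern_translate:
  "\<lbrakk>a \<in> carrier L; b \<in> carrier L; c \<in> carrier L\<rbrakk> \<Longrightarrow>
     \<langle>s \<oplus>\<^bsub>L\<^esub> a, s \<oplus>\<^bsub>L\<^esub> b, s \<oplus>\<^bsub>L\<^esub> c\<rangle>\<^bsub>A\<^esub> = s \<oplus>\<^bsub>L\<^esub> (a \<ominus>\<^bsub>L\<^esub> b \<oplus>\<^bsub>L\<^esub> c)"
  by (simp add: tern_eq s_closed L.translate_minus)

lemma act_translate:
  "\<lbrakk>\<alpha> \<in> carrier K; a \<in> carrier L; b \<in> carrier L\<rbrakk> \<Longrightarrow>
     act A \<alpha> (s \<oplus>\<^bsub>L\<^esub> a) (s \<oplus>\<^bsub>L\<^esub> b) =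
       s \<oplus>\<^bsub>L\<^esub> ((\<one>\<^bsub>K\<^esub> \<ominus>\<^bsub>K\<^esub> \<alpha>) \<odot>\<^bsub>L\<^esub> a \<oplus>\<^bsub>L\<^esub> \<alpha> \<odot>\<^bsub>L\<^esub> b)"
  by (simp add: act_eq s_closed L.translate_smult)

section \<open>Lie algebra laws of the tangent bracket\<close>

lemma zero_bracket:
  assumes "x \<in> carrier L"
  shows "\<zero>\<^bsub>L\<^esub> \<otimes>\<^bsub>L\<^esub> x = \<zero>\<^bsub>L\<^esub>" "x \<otimes>\<^bsub>L\<^esub> \<zero>\<^bsub>L\<^esub> = \<zero>\<^bsub>L\<^esub>"
proof -
  have [simp]: "\<zero>\<^bsub>L\<^esub> = p" by (simp add: tangent_lie_algebra_simps)
  have *: "\<lbrace>x, p\<rbrace>\<^bsub>A\<^esub> \<in> carrier L" "\<lbrace>p, x\<rbrace>\<^bsub>A\<^esub> \<in> carrier L" "\<lbrace>p, p\<rbrace>\<^bsub>A\<^esub> \<in> carrier L"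
    using assms p_closed abr_closed by (simp_all add: carrier_eq)
  show "\<zero>\<^bsub>L\<^esub> \<otimes>\<^bsub>L\<^esub> x = \<zero>\<^bsub>L\<^esub>" "x \<otimes>\<^bsub>L\<^esub> \<zero>\<^bsub>L\<^esub> = \<zero>\<^bsub>L\<^esub>"
    using * L.r_neg L.l_neg L.l_zero L.r_zero L.a_assoc
    by (simp_all add: tangent_lie_algebra_mult L.minus_eq)
qed

text \<open>This is affine antisymmetry after \<open>s\<close> has been cancelled from both
  sides.\<close>

lemma bracket_skew:
  assumes "x \<in> carrier L" "y \<in> carrier L"
  shows "x \<otimes>\<^bsub>L\<^esub> y \<ominus>\<^bsub>L\<^esub> x \<otimes>\<^bsub>L\<^esub> x \<oplus>\<^bsub>L\<^esub> y \<otimes>\<^bsub>L\<^esub> x = y \<otimes>\<^bsub>L\<^esub> y"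
  using abr_antisym[of x y] assms s_closed
  by (simp add: carrier_eq abr_eq tern_translate bracket_closed)

text \<open>Skewness for the pair 0, x has only zero terms on the left.\<close>

lemma bracket_self: "x \<in> carrier L \<Longrightarrow> x \<otimes>\<^bsub>L\<^esub> x = \<zero>\<^bsub>L\<^esub>"
  using bracket_skew[of "\<zero>\<^bsub>L\<^esub>" x] by (simp add: zero_bracket L.minus_eq L.a_inv_zero)

text \<open>Centrality is assumed with \<open>s\<close> on the left; in \<open>bracket_skew\<close>
  for s, x every term except [x, s] vanishes.\<close>

lemma bracket_s:
  assumes "x \<in> carrier L"
  shows "x \<otimes>\<^bsub>L\<^esub> s = \<zero>\<^bsub>L\<^esub>"
  using bracket_skew[of s x] assms s_closed s_central
  by (simp add: bracket_self L.minus_eq L.a_inv_zero bracket_closed)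

text \<open>After removal of \<open>s\<close>, the bracket with \<open>z\<close> is an affine map
  that sends 0 to 0, hence additive: x + y is the heap operation on x, 0, y.\<close>

lemma bracket_add_left:
  assumes "x \<in> carrier L" "y \<in> carrier L" "z \<in> carrier L"
  shows "(x \<oplus>\<^bsub>L\<^esub> y) \<otimes>\<^bsub>L\<^esub> z = (x \<otimes>\<^bsub>L\<^esub> z) \<oplus>\<^bsub>L\<^esub> (y \<otimes>\<^bsub>L\<^esub> z)"
proof -
  have "\<lbrace>\<langle>x, \<zero>\<^bsub>L\<^esub>, y\<rangle>\<^bsub>A\<^esub>, z\<rbrace>\<^bsub>A\<^esub> = \<langle>\<lbrace>x, z\<rbrace>\<^bsub>A\<^esub>, \<lbrace>\<zero>\<^bsub>L\<^esub>, z\<rbrace>\<^bsub>A\<^esub>, \<lbrace>y, z\<rbrace>\<^bsub>A\<^esub>\<rangle>\<^bsub>A\<^esub>"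
    using abr_affine_left[of z] assms by (simp add: affine_map_on_def carrier_eq)
  (* zero_bracket is kept for a second pass: it would reduce s + [0, z] to s and hide the translate
     that tern_translate has to match. *)
  then show ?thesis
    using assms s_closed
    by (simp add: tern_translate abr_eq tern_eq[of x] bracket_closed)
      (simp add: zero_bracket bracket_closed L.minus_eq L.a_inv_zero)
qed

lemma bracket_add_right:
  assumes "x \<in> carrier L" "y \<in> carrier L" "z \<in> carrier L"
  shows "x \<otimes>\<^bsub>L\<^esub> (y \<oplus>\<^bsub>L\<^esub> z) = (x \<otimes>\<^bsub>L\<^esub> y) \<oplus>\<^bsub>L\<^esub> (x \<otimes>\<^bsub>L\<^esub> z)"
proof -
  have "\<lbrace>x, \<langle>y, \<zero>\<^bsub>L\<^esub>, z\<rangle>\<^bsub>A\<^esub>\<rbrace>\<^bsub>A\<^esub> = \<langle>\<lbrace>x, y\<rbrace>\<^bsub>A\<^esub>, \<lbrace>x, \<zero>\<^bsub>L\<^esub>\<rbrace>\<^bsub>A\<^esub>, \<lbrace>x, z\<rbrace>\<^bsub>A\<^esub>\<rangle>\<^bsub>A\<^esub>"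
    using abr_affine_right[of x] assms by (simp add: affine_map_on_def carrier_eq)
  then show ?thesis
    using assms s_closed
    by (simp add: tern_translate abr_eq tern_eq[of y] bracket_closed)
      (simp add: zero_bracket bracket_closed L.minus_eq L.a_inv_zero)
qed

lemma bracket_smult:
  assumes "\<alpha> \<in> carrier K" "x \<in> carrier L" "y \<in> carrier L"
  shows "(\<alpha> \<odot>\<^bsub>L\<^esub> x) \<otimes>\<^bsub>L\<^esub> y = \<alpha> \<odot>\<^bsub>L\<^esub> (x \<otimes>\<^bsub>L\<^esub> y)"
    and "x \<otimes>\<^bsub>L\<^esub> (\<alpha> \<odot>\<^bsub>L\<^esub> y) = \<alpha> \<odot>\<^bsub>L\<^esub> (x \<otimes>\<^bsub>L\<^esub> y)"
proof -
  \<comment> \<open>This local fact concerns the base point 0 and hides the axiom of the same name,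
    which concerns the scalar 0.\<close>
  have act_zero: "act A \<alpha> \<zero>\<^bsub>L\<^esub> z = \<alpha> \<odot>\<^bsub>L\<^esub> z" for z
    by (simp add: tangent_lie_algebra_simps)
  have "\<lbrace>act A \<alpha> \<zero>\<^bsub>L\<^esub> x, y\<rbrace>\<^bsub>A\<^esub> = act A \<alpha> \<lbrace>\<zero>\<^bsub>L\<^esub>, y\<rbrace>\<^bsub>A\<^esub> \<lbrace>x, y\<rbrace>\<^bsub>A\<^esub>"
    using abr_affine_left[of y] assms by (simp add: affine_map_on_def carrier_eq)
  then show "(\<alpha> \<odot>\<^bsub>L\<^esub> x) \<otimes>\<^bsub>L\<^esub> y = \<alpha> \<odot>\<^bsub>L\<^esub> (x \<otimes>\<^bsub>L\<^esub> y)"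
    using assms s_closed
    by (simp add: act_translate abr_eq act_zero bracket_closed)
      (simp add: zero_bracket bracket_closed)
  have "\<lbrace>x, act A \<alpha> \<zero>\<^bsub>L\<^esub> y\<rbrace>\<^bsub>A\<^esub> = act A \<alpha> \<lbrace>x, \<zero>\<^bsub>L\<^esub>\<rbrace>\<^bsub>A\<^esub> \<lbrace>x, y\<rbrace>\<^bsub>A\<^esub>"
    using abr_affine_right[of x] assms by (simp add: affine_map_on_def carrier_eq)
  then show "x \<otimes>\<^bsub>L\<^esub> (\<alpha> \<odot>\<^bsub>L\<^esub> y) = \<alpha> \<odot>\<^bsub>L\<^esub> (x \<otimes>\<^bsub>L\<^esub> y)"
    using assms s_closed
    by (simp add: act_translate abr_eq act_zero bracket_closed)
      (simp add: zero_bracket bracket_closed)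
qed

text \<open>Because [x, s] = 0, a translation of the second argument by \<open>s\<close> goes
  unnoticed. Hence nested brackets carry \<open>s\<close> only once, and the two central series can
  be compared step by step.\<close>

lemma abr_translate:
  assumes "x \<in> carrier L" "y \<in> carrier L"
  shows "\<lbrace>x, s \<oplus>\<^bsub>L\<^esub> y\<rbrace>\<^bsub>A\<^esub> = s \<oplus>\<^bsub>L\<^esub> x \<otimes>\<^bsub>L\<^esub> y"
  using assms s_closed by (simp add: abr_eq bracket_add_right bracket_s bracket_closed)

text \<open>Every nested affine bracket is \<open>s\<close> plus the nested Lie bracket, so
  \<open>s\<close> cancels from the affine Jacobi identity; its correction terms [a, [a, a]] vanish
  by alternation.\<close>

lemma bracket_jacobi:
  assumes "x \<in> carrier L" "y \<in> carrier L" "z \<in> carrier L"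
  shows "(x \<otimes>\<^bsub>L\<^esub> (y \<otimes>\<^bsub>L\<^esub> z)) \<oplus>\<^bsub>L\<^esub> (y \<otimes>\<^bsub>L\<^esub> (z \<otimes>\<^bsub>L\<^esub> x)) \<oplus>\<^bsub>L\<^esub> (z \<otimes>\<^bsub>L\<^esub> (x \<otimes>\<^bsub>L\<^esub> y)) = \<zero>\<^bsub>L\<^esub>"
proof -
  have nested: "\<lbrace>a, \<lbrace>b, c\<rbrace>\<^bsub>A\<^esub>\<rbrace>\<^bsub>A\<^esub> = s \<oplus>\<^bsub>L\<^esub> a \<otimes>\<^bsub>L\<^esub> (b \<otimes>\<^bsub>L\<^esub> c)"
    if "a \<in> carrier L" "b \<in> carrier L" "c \<in> carrier L" for a b c
    using that by (simp add: abr_eq[of b c] abr_translate bracket_closed)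
  show ?thesis
    using abr_jacobi[of x y z] assms s_closed
    by (simp add: carrier_eq nested tern_translate bracket_closed)
      (simp add: bracket_closed bracket_self zero_bracket L.minus_eq L.a_inv_zero)
qed

text \<open>Required because \<open>nilpotent_lie_algebra\<close> includes the Lie algebra
  laws.\<close>

lemma lie_algebra_tangent: "lie_algebra K L"
  by unfold_locales
    (simp_all add: bracket_closed bracket_add_left bracket_add_right bracket_smult
      bracket_self bracket_jacobi)

section \<open>Affine subspaces through \<open>s\<close> and linear subspaces\<close>

lemma affine_subspace_translate:
  assumes "submodule H K L"
  shows "affine_subspace K A ((\<oplus>\<^bsub>L\<^esub>) s ` H)"
proof -
  have H: "\<And>x. x \<in> H \<Longrightarrow> x \<in> carrier L"
    using L.submoduleE(1)[OF assms] by blast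
  have "a \<ominus>\<^bsub>L\<^esub> b \<oplus>\<^bsub>L\<^esub> c \<in> H" if "a \<in> H" "b \<in> H" "c \<in> H" for a b c
    using that by (simp add: L.minus_eq L.submoduleE(3,5)[OF assms])
  moreover have "(\<one>\<^bsub>K\<^esub> \<ominus>\<^bsub>K\<^esub> \<alpha>) \<odot>\<^bsub>L\<^esub> a \<oplus>\<^bsub>L\<^esub> \<alpha> \<odot>\<^bsub>L\<^esub> b \<in> H"
    if "\<alpha> \<in> carrier K" "a \<in> H" "b \<in> H" for \<alpha> a b
    using that by (simp add: L.submoduleE(4,5)[OF assms])
  ultimately show ?thesis
    using s_closed H by (auto simp: affine_subspace_def carrier_eq tern_translate act_translate)
qed

text \<open>With s = s + 0 as base point, the linear operations become affine ones: -a comes from s,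
  s + a, s; a + b from s + a, s, s + b; and \<alpha> a from the action based at
  \<open>s\<close>.\<close>

lemma submodule_untranslate:
  assumes B: "affine_subspace K A B" and s: "s \<in> B"
  shows "submodule {x \<in> carrier L. s \<oplus>\<^bsub>L\<^esub> x \<in> B} K L"
proof -
  have tern: "\<And>a b c. \<lbrakk>a \<in> B; b \<in> B; c \<in> B\<rbrakk> \<Longrightarrow> \<langle>a, b, c\<rangle>\<^bsub>A\<^esub> \<in> B"
    and act: "\<And>\<alpha> a b. \<lbrakk>\<alpha> \<in> carrier K; a \<in> B; b \<in> B\<rbrakk> \<Longrightarrow> act A \<alpha> a b \<in> B"
    using B by (auto simp: affine_subspace_def)
  have s0: "s \<oplus>\<^bsub>L\<^esub> \<zero>\<^bsub>L\<^esub> \<in> B"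
    using s s_closed by simp
  have "s \<oplus>\<^bsub>L\<^esub> \<ominus>\<^bsub>L\<^esub> a \<in> B" if "a \<in> carrier L" "s \<oplus>\<^bsub>L\<^esub> a \<in> B" for a
    using tern[OF s0 that(2) s0] that(1) by (simp add: tern_translate L.minus_eq)
  moreover have "s \<oplus>\<^bsub>L\<^esub> (a \<oplus>\<^bsub>L\<^esub> b) \<in> B"
    if "a \<in> carrier L" "s \<oplus>\<^bsub>L\<^esub> a \<in> B" "b \<in> carrier L" "s \<oplus>\<^bsub>L\<^esub> b \<in> B" for a b
    using tern[OF that(2) s0 that(4)] that(1,3) by (simp add: tern_translate L.minus_eq L.a_inv_zero)
  moreover have "s \<oplus>\<^bsub>L\<^esub> \<alpha> \<odot>\<^bsub>L\<^esub> a \<in> B"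
    if "\<alpha> \<in> carrier K" "a \<in> carrier L" "s \<oplus>\<^bsub>L\<^esub> a \<in> B" for \<alpha> a
    using act[OF that(1) s0 that(3)] that(1,2) by (simp add: act_translate)
  ultimately show ?thesis
    using s0 by (intro L.submoduleI) auto
qed

section \<open>Comparison of the two central series\<close>

lemma submodule_lower_central_series: "submodule (lower_central_series K L m) K L"
proof (induction m)
  case 0
  then show ?case by (simp add: L.carrier_is_submodule)
next
  case (Suc m)
  then show ?case
    using L.submoduleE(1)[OF Suc] bracket_closed
    by (auto simp: lie_bracket_sets_def intro!: L.submodule_hull)
qed

lemma affine_lower_central_series_eq:
  "affine_lower_central_series K A m = (\<oplus>\<^bsub>L\<^esub>) s ` lower_central_series K L m"
proof (induction m)
  case 0
  \<comment> \<open>Translation by \<open>s\<close> is onto, with preimage -s + x.\<close>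
  have "x = s \<oplus>\<^bsub>L\<^esub> (\<ominus>\<^bsub>L\<^esub> s \<oplus>\<^bsub>L\<^esub> x)" if "x \<in> carrier L" for x
    using that s_closed by (simp add: L.r_neg2)
  then show ?case
    using s_closed by (auto simp: carrier_eq intro!: image_eqI)
next
  case (Suc m)
  let ?H = "lower_central_series K L m"
  let ?H' = "lower_central_series K L (Suc m)"
  let ?gens = "{\<lbrace>x, y\<rbrace>\<^bsub>A\<^esub> | x y. x \<in> carrier A \<and> y \<in> affine_lower_central_series K A m}"
  let ?B = "affine_subspace K A hull ?gens"
  have H: "\<And>x. x \<in> ?H \<Longrightarrow> x \<in> carrier L"
    using L.submoduleE(1)[OF submodule_lower_central_series[of m]] by blast
  \<comment> \<open>By the induction hypothesis the second argument runs over s + H, and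
    \<open>abr_translate\<close> absorbs that shift.\<close>
  have gens: "?gens = {s \<oplus>\<^bsub>L\<^esub> x \<otimes>\<^bsub>L\<^esub> y | x y. x \<in> carrier L \<and> y \<in> ?H}"
    unfolding Suc carrier_eq using H abr_translate by (auto simp: image_iff) metis+
  have bracket: "x \<otimes>\<^bsub>L\<^esub> y \<in> ?H'" if "x \<in> carrier L" "y \<in> ?H" for x y
    using that by (auto simp: lie_bracket_sets_def intro!: hull_inc)
  have "?B \<subseteq> (\<oplus>\<^bsub>L\<^esub>) s ` ?H'"
  proof (rule hull_minimal)
    show "?gens \<subseteq> (\<oplus>\<^bsub>L\<^esub>) s ` ?H'"
      unfolding gens using bracket by blast
  qed (rule affine_subspace_translate[OF submodule_lower_central_series])
  \<comment> \<open>For the reverse inclusion, each affine subspace \<open>C\<close> that competes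
    in the affine hull is pulled back to a submodule containing all generating brackets.\<close>
  moreover have "s \<oplus>\<^bsub>L\<^esub> z \<in> C" if z: "z \<in> ?H'" and C: "affine_subspace K A C" "?gens \<subseteq> C" for z C
  proof -
    have C': "s \<oplus>\<^bsub>L\<^esub> x \<otimes>\<^bsub>L\<^esub> y \<in> C" if "x \<in> carrier L" "y \<in> ?H" for x y
      using C(2) that unfolding gens by blast
    have "\<zero>\<^bsub>L\<^esub> \<in> ?H"
      by (rule L.zero_in_submodule[OF submodule_lower_central_series])
    \<comment> \<open>The pullback is a submodule only if \<open>C\<close> passes through
      \<open>s\<close>; the generator with both Lie arguments 0 is \<open>s\<close> itself.\<close>
    then have "s \<in> C"
      using C'[of "\<zero>\<^bsub>L\<^esub>" "\<zero>\<^bsub>L\<^esub>"] s_closed by (simp add: zero_bracket)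
    then have "?H' \<subseteq> {x \<in> carrier L. s \<oplus>\<^bsub>L\<^esub> x \<in> C}"
      unfolding lower_central_series.simps lie_bracket_sets_def
      using C' H bracket_closed by (intro hull_minimal submodule_untranslate[OF C(1)]) auto
    then show ?thesis
      using z by blast
  qed
  then have "(\<oplus>\<^bsub>L\<^esub>) s ` ?H' \<subseteq> ?B"
    unfolding hull_def by blast
  ultimately show ?case
    by (simp add: affine_bracket_sets_def)
qed

section \<open>The absorbing element and nilpotency\<close>

text \<open>Testing an absorbing \<open>x\<close> against 0 alone forces x = {x, 0} = s; conversely
  \<open>s\<close> absorbs because its brackets vanish on both sides.\<close>

lemma absorbing_set_eq: "absorbing_set A = {s}"
proof -
  have "x = s" if "x \<in> carrier L" "\<lbrace>x, \<zero>\<^bsub>L\<^esub>\<rbrace>\<^bsub>A\<^esub> = x" for x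
    using that s_closed by (simp add: abr_eq zero_bracket)
  moreover have "\<lbrace>s, a\<rbrace>\<^bsub>A\<^esub> = s \<and> \<lbrace>a, s\<rbrace>\<^bsub>A\<^esub> = s" if "a \<in> carrier L" for a
    using that s_closed s_central by (simp add: abr_eq bracket_s)
  ultimately show ?thesis
    using s_closed L.zero_closed unfolding absorbing_set_def carrier_eq by blast
qed

lemma affine_lower_central_series_eq_absorbing_iff:
  "affine_lower_central_series K A m = absorbing_set A \<longleftrightarrow> lower_central_series K L m = {\<zero>\<^bsub>L\<^esub>}"
proof
  assume "affine_lower_central_series K A m = absorbing_set A"
  then have "s \<oplus>\<^bsub>L\<^esub> x = s \<oplus>\<^bsub>L\<^esub> \<zero>\<^bsub>L\<^esub>" if "x \<in> lower_central_series K L m" for x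
    using that s_closed unfolding affine_lower_central_series_eq absorbing_set_eq by auto
  then have "x = \<zero>\<^bsub>L\<^esub>" if "x \<in> lower_central_series K L m" for x
    using that s_closed L.submoduleE(1)[OF submodule_lower_central_series[of m]]
      L.add.l_cancel[of s x "\<zero>\<^bsub>L\<^esub>"] by blast
  then show "lower_central_series K L m = {\<zero>\<^bsub>L\<^esub>}"
    using L.zero_in_submodule[OF submodule_lower_central_series[of m]] by blast
next
  assume "lower_central_series K L m = {\<zero>\<^bsub>L\<^esub>}"
  then show "affine_lower_central_series K A m = absorbing_set A"
    using s_closed by (simp add: affine_lower_central_series_eq absorbing_set_eq)
qed

lemma lower_central_series_stable:
  assumes "lower_central_series K L n = {\<zero>\<^bsub>L\<^esub>}"
  shows "lower_central_series K L (n + k) = {\<zero>\<^bsub>L\<^esub>}"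
proof (induction k)
  case (Suc k)
  \<comment> \<open>The zero submodule is available as the \<open>n\<close>-th term of the
    series.\<close>
  have "submodule {\<zero>\<^bsub>L\<^esub>} K L"
    using submodule_lower_central_series[of n] by (simp only: assms)
  then have "lower_central_series K L (Suc (n + k)) \<subseteq> {\<zero>\<^bsub>L\<^esub>}"
    unfolding lower_central_series.simps lie_bracket_sets_def Suc
    by (intro hull_minimal) (auto simp: zero_bracket)
  then show ?case
    using L.zero_in_submodule[OF submodule_lower_central_series[of "Suc (n + k)"]]
    by (metis add_Suc_right empty_iff subset_singletonD)
qed (simp add: assms)

lemma affinely_nilpotent_iff: "affinely_nilpotent K A \<longleftrightarrow> nilpotent_lie_algebra K L"
proof
  assume "affinely_nilpotent K A"
  then show "nilpotent_lie_algebra K L"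
    unfolding affinely_nilpotent_def nilpotent_lie_algebra_def
    using affine_lower_central_series_eq_absorbing_iff lie_algebra_tangent by blast
next
  assume "nilpotent_lie_algebra K L"
  then obtain n where "lower_central_series K L n = {\<zero>\<^bsub>L\<^esub>}"
    unfolding nilpotent_lie_algebra_def by blast
  then have "affine_lower_central_series K A (n + k) = absorbing_set A" for k
    using lower_central_series_stable affine_lower_central_series_eq_absorbing_iff by blast
  \<comment> \<open>Affine nilpotency demands a positive index, whereas \<open>n\<close> may be 0
    when the algebra is zero; stability permits the shift to \<open>Suc n\<close>.\<close>
  then have "affine_lower_central_series K A (Suc n + k) = absorbing_set A" for k
    by (metis add_Suc_shift)
  then show "affinely_nilpotent K A"
    unfolding affinely_nilpotent_def using lie_affgebra_axioms
    by (metis add_0_right zero_less_Suc)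
qed

end

theorem theorem6p2:
  fixes K :: "('k, 'm) ring_scheme"
    and A :: "('k, 'a) affgebra"
    and p s :: 'a
  assumes "field K"
    and "ring_char K \<noteq> 2"
    and "lie_affgebra K A"
    and "p \<in> carrier A"
    and "s \<in> carrier (tangent_lie_algebra A p)"
    and "affgebra_eq K A
           (affgebra_of K (tangent_lie_algebra A p)
              (\<lambda>x. \<zero>\<^bsub>tangent_lie_algebra A p\<^esub>) (\<lambda>x. \<zero>\<^bsub>tangent_lie_algebra A p\<^esub>) s)"
    and "\<forall>x \<in> carrier (tangent_lie_algebra A p).
           s \<otimes>\<^bsub>tangent_lie_algebra A p\<^esub> x = \<zero>\<^bsub>tangent_lie_algebra A p\<^esub>"
  shows "affinely_nilpotent K A \<longleftrightarrow> nilpotent_lie_algebra K (tangent_lie_algebra A p)"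
proof -
  interpret central_lie_affgebra K A p s
    using assms by (simp add: central_lie_affgebra_def central_lie_affgebra_axioms_def)
  show ?thesis
    by (rule affinely_nilpotent_iff)
qed

end
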